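(* Let $D\subseteq\mathbb{C}$ be open, let $\varphi_1,\varphi_2,\psi$ be analytic functions on $D$, let $\alpha,\beta\in\mathbb{R}^{+}\setminus\{1\}$, and for $n=0,1,2,\dots$ let $\Theta_n(x)=\alpha^{\varphi_1(x)}\frac{d^n}{dx^n}\left(\psi(x)\beta^{-\varphi_2(x)}\right)$. Let $r\in\mathbb{N}_0$, $\lambda\in\mathbb{C}$, $p\in\mathbb{N}$, let $(a_k)_{k\ge0}$ be a sequence of nonzero numbers, and let $\mu,\nu\in\mathbb{C}$ be such that $\mu+\nu k\in\mathbb{N}_0$ for all $k\ge0$. Put $$\Lambda_{\mu,\nu}(y;z):=\sum_{k=0}^{\infty}a_k\,\mathcal{B}^{(r)}_{\mu+\nu k}(y;\lambda)\,z^k$$ and, for $n=0,1,2,\dots$, $$\Phi_{n,p,\mu,\nu}(x;y;\zeta):=\sum_{k=0}^{[n/p]}\frac{a_k}{(n-pk)!}\,\Theta_{n-pk}(x)\,\mathcal{B}^{(r)}_{\mu+\nu k}(y;\lambda)\,\zeta^k,$$ where $\mathcal{B}^{(r)}_{m}(y;\lambda)$ are the Apostol-Bernoulli polynomials of order $r$. Then, for $x\in D$ and $t\ne0$ with $|t|$ sufficiently small (depending on $x$), $$\sum_{n=0}^{\infty}\Phi_{n,p,\mu,\nu}\!\left(x;y;\frac{\eta}{t^p}\right)t^n=\alpha^{\varphi_1(x)}\,\psi(x+t)\,\beta^{-\varphi_2(x+t)}\,\Lambda_{\mu,\nu}(y;\eta),$$ provided that each member of this identity exists (i.e. the series on both sides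 converge).
   Context: For $c>0$ and $w\in\mathbb{C}$, $c^{w}=e^{w\ln c}$ with $\ln$ the real natural logarithm. $[n/p]$ denotes the integer part of $n/p$. The Apostol-Bernoulli polynomials $\mathcal{B}^{(r)}_m(x;\lambda)$ of order $r\in\mathbb{N}_0$ ($\lambda\in\mathbb{C}$) are defined by the generating function $$\left(\frac{t}{\lambda e^{t}-1}\right)^{r}e^{xt}=\sum_{m=0}^{\infty}\mathcal{B}^{(r)}_m(x;\lambda)\frac{t^m}{m!},$$ valid for $|t|<2\pi$ when $\lambda=1$ and for $|t|<|\log\lambda|$ when $\lambda\ne1$. *)

theory Defs
  imports "HOL-Complex_Analysis.Complex_Analysis"
begin

text \<open>
  The generating function is taken as a formal power series in \<open>t\<close>, with \<open>m\<close>-th coefficient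
  \<open>B\<^sub>m / m!\<close>. For \<open>lam = 1\<close> the denominator has subdegree 1 and the factor \<open>t\<close> cancels in the
  quotient of formal power series. The lemma \<open>apostol_bernoulli_gf\<close> below gives the corresponding
  identity between a convergent series and a function on the usual disc.
\<close>

definition apostol_bernoulli_fps :: "nat \<Rightarrow> complex \<Rightarrow> complex \<Rightarrow> complex fps" where
  "apostol_bernoulli_fps r x lam =
     (fps_X / (fps_const lam * fps_exp 1 - 1)) ^ r * fps_exp x"

definition apostol_bernoulli :: "nat \<Rightarrow> nat \<Rightarrow> complex \<Rightarrow> complex \<Rightarrow> complex" where
  "apostol_bernoulli r m x lam = fact m * fps_nth (apostol_bernoulli_fps r x lam) m"

lemma norm_Ln_le_of_exp_eq:
  assumes "lam \<noteq> 0" "lam * exp z = 1"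
  shows "norm (Ln lam) \<le> norm z"
proof -
  have "exp (-z) = lam"
    using assms by (simp add: exp_minus field_simps)
  then have "exp (Ln lam) = exp (-z)"
    using assms by simp
  then obtain n :: int where n: "Ln lam = -z + (of_int (2 * n) * pi) * \<i>"
    unfolding exp_eq by blast
  have re: "Re (Ln lam) = - Re z" and im: "Im (Ln lam) = - Im z + 2 * of_int n * pi"
    using arg_cong[OF n, of Re] arg_cong[OF n, of Im] by simp_all
  have b: "\<bar>Im (Ln lam)\<bar> \<le> pi"
    using Im_Ln_le_pi[OF assms(1)] mpi_less_Im_Ln[OF assms(1)] by linarith
  have "\<bar>Im (Ln lam)\<bar> \<le> \<bar>Im z\<bar>"
  proof (cases "n = 0")
    case False
    then have "1 \<le> \<bar>real_of_int n\<bar>" by linarith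
    then have "2 * pi \<le> \<bar>2 * of_int n * pi\<bar>"
      using pi_gt_zero by (simp add: abs_mult)
    then show ?thesis using im b by linarith
  qed (use im in simp)
  then have "(Im (Ln lam))\<^sup>2 \<le> (Im z)\<^sup>2"
    by (simp add: abs_le_square_iff)
  then show ?thesis
    unfolding cmod_def using re by simp
qed

lemma norm_ge_2pi_of_exp_eq_1:
  assumes "exp z = 1" "(z :: complex) \<noteq> 0"
  shows "2 * pi \<le> norm z"
proof -
  obtain n :: int where n: "Re z = 0" "Im z = of_int (2 * n) * pi"
    using assms(1) unfolding exp_eq_1 by blast
  with assms(2) have "n \<noteq> 0" by (auto simp: complex_eq_iff)
  then have "1 \<le> \<bar>real_of_int n\<bar>" by linarith
  then have "2 * pi \<le> \<bar>Im z\<bar>"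
    using pi_gt_zero n by (simp add: abs_mult)
  also have "\<dots> \<le> norm z" by (rule abs_Im_le_cmod)
  finally show ?thesis .
qed

lemma apostol_bernoulli_gf:
  assumes "lam = 1 \<Longrightarrow> norm t < 2 * pi"
    and "lam \<noteq> 1 \<Longrightarrow> lam \<noteq> 0 \<Longrightarrow> norm t < norm (Ln lam)"
    and "t \<noteq> 0"
  shows "(\<lambda>m. apostol_bernoulli r m x lam * t ^ m / fact m) sums
           ((t / (lam * exp t - 1)) ^ r * exp (x * t))"
proof -
  define g :: "complex fps" where "g = fps_const lam * fps_exp 1 - 1"
  define R :: real where
    "R = (if lam = 1 then 2 * pi else if lam = 0 then norm t + 1 else norm (Ln lam))"
  have tR: "norm t < R" using assms by (auto simp: R_def)
  have cexp: "fps_conv_radius (fps_const lam * fps_exp 1 :: complex fps) = \<infinity>"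
    using fps_conv_radius_mult[of "fps_const lam" "fps_exp 1"] by simp
  have cg: "fps_conv_radius g = \<infinity>"
    using fps_conv_radius_diff[of "fps_const lam * fps_exp 1" 1] cexp unfolding g_def by simp
  have eg: "eval_fps g z = lam * exp z - 1" for z
    unfolding g_def using cexp by (simp add: eval_fps_diff eval_fps_mult)
  have nz: "eval_fps g z \<noteq> 0" if "norm z < R" "z \<noteq> 0" for z
    using that norm_Ln_le_of_exp_eq[of lam z] norm_ge_2pi_of_exp_eq_1[of z]
    by (auto simp: eg R_def split: if_splits)
  have g01: "fps_nth g 0 = lam - 1" "fps_nth g 1 = lam"
    by (simp_all add: g_def)
  have gnz: "g \<noteq> 0"
    using g01 by (metis fps_zero_nth right_minus_eq zero_neq_one)
  have sub: "subdegree g \<le> 1"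
  proof (cases "lam = 1")
    case True
    then show ?thesis using g01 by (intro subdegree_leI) simp
  next
    case False
    then have "subdegree g \<le> 0" using g01 by (intro subdegree_leI) simp
    then show ?thesis by simp
  qed
  have nzs: "eval_fps g z \<noteq> 0" if "z \<in> eball 0 (ereal R)" "z \<noteq> 0" for z
    using that nz by (simp add: dist_norm)
  have Rpos: "0 < R" using tR norm_ge_zero[of t] by linarith
  have c: "fps_conv_radius (fps_X / g) \<ge> ereal R"
    using fps_conv_radius_divide[of g fps_X "ereal R"] Rpos sub gnz nzs cg by simp
  have e: "eval_fps (fps_X / g) t = t / (lam * exp t - 1)"
    using eval_fps_divide[of g fps_X "ereal R" t] Rpos sub gnz nzs cg tR assms(3) eg by simp
  have t1: "ereal (norm t) < fps_conv_radius (fps_X / g)"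
    using tR c by (meson ereal_less(2) less_ereal.simps(1) less_le_trans)
  then have t2: "ereal (norm t) < fps_conv_radius ((fps_X / g) ^ r)"
    by (meson fps_conv_radius_power less_le_trans)
  have t3: "ereal (norm t) < fps_conv_radius ((fps_X / g) ^ r * fps_exp x)"
    using t2 fps_conv_radius_mult[of "(fps_X / g) ^ r" "fps_exp x"] by simp
  have "eval_fps ((fps_X / g) ^ r * fps_exp x) t = (t / (lam * exp t - 1)) ^ r * exp (x * t)"
    using t1 t2 e by (simp add: eval_fps_mult eval_fps_power)
  with sums_eval_fps[OF t3] show ?thesis
    by (simp add: apostol_bernoulli_def apostol_bernoulli_fps_def g_def)
qed

text \<open>
  For \<open>c > 0\<close> and complex \<open>w\<close>, \<open>of_real c powr w\<close> is \<open>exp (w * of_real (ln c))\<close>.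
\<close>

definition Theta ::
  "real \<Rightarrow> real \<Rightarrow> (complex \<Rightarrow> complex) \<Rightarrow> (complex \<Rightarrow> complex) \<Rightarrow> (complex \<Rightarrow> complex)
    \<Rightarrow> nat \<Rightarrow> complex \<Rightarrow> complex" where
  "Theta \<alpha> \<beta> \<phi>1 \<phi>2 \<psi> n x =
     of_real \<alpha> powr \<phi>1 x * (deriv ^^ n) (\<lambda>x. \<psi> x * of_real \<beta> powr (- \<phi>2 x)) x"

text \<open>
  The subscript \<open>\<mu> + \<nu> k\<close> is a complex number required to lie in \<open>\<nat>\<close>;
  \<open>nat_of w\<close> is the natural number equal to \<open>w\<close>, and is only meaningful for \<open>w \<in> \<nat>\<close>.
\<close>

definition nat_of :: "complex \<Rightarrow> nat" where
  "nat_of w = (THE m. of_nat m = w)"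

lemma nat_of_of_nat [simp]: "nat_of (of_nat m) = m"
  by (simp add: nat_of_def)

definition Lambda_term ::
  "(nat \<Rightarrow> complex) \<Rightarrow> nat \<Rightarrow> complex \<Rightarrow> complex \<Rightarrow> complex \<Rightarrow> complex \<Rightarrow> complex \<Rightarrow> nat \<Rightarrow> complex" where
  "Lambda_term a r lam \<mu> \<nu> y z k =
     a k * apostol_bernoulli r (nat_of (\<mu> + \<nu> * of_nat k)) y lam * z ^ k"

definition Lambda ::
  "(nat \<Rightarrow> complex) \<Rightarrow> nat \<Rightarrow> complex \<Rightarrow> complex \<Rightarrow> complex \<Rightarrow> complex \<Rightarrow> complex \<Rightarrow> complex" where
  "Lambda a r lam \<mu> \<nu> y z = (\<Sum>k. Lambda_term a r lam \<mu> \<nu> y z k)"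

definition Phi ::
  "(nat \<Rightarrow> complex \<Rightarrow> complex) \<Rightarrow> (nat \<Rightarrow> complex) \<Rightarrow> nat \<Rightarrow> complex
    \<Rightarrow> nat \<Rightarrow> nat \<Rightarrow> complex \<Rightarrow> complex \<Rightarrow> complex \<Rightarrow> complex \<Rightarrow> complex \<Rightarrow> complex" where
  "Phi \<Theta> a r lam n p \<mu> \<nu> x y \<zeta> =
     (\<Sum>k = 0..n div p. a k / fact (n - p * k) * \<Theta> (n - p * k) x
        * apostol_bernoulli r (nat_of (\<mu> + \<nu> * of_nat k)) y lam * \<zeta> ^ k)"

end

theory Submission
  imports Defs
begin

text \<open>
  After cancelling the powers of \<open>t\<close>, the left-hand side is the Cauchy product of the Taylor series
  of \<open>s \<mapsto> \<psi> (x + s) \<beta> powr (- \<phi>2 (x + s))\<close> with the series for \<open>\<Lambda>\<close>, the latter spread out so that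
  its \<open>k\<close>-th term sits at index \<open>p k\<close>. The Taylor series converges absolutely inside its disc, so
  Mertens' theorem applies even if the series for \<open>\<Lambda>\<close> converges only conditionally.
\<close>

text \<open>Only the partial sums of \<open>a\<close> need to be bounded: each partial product sum
  is regrouped by the index of \<open>b\<close>, and the term at \<open>j\<close> is then at most
  \<open>K * norm (b j)\<close> uniformly in \<open>n\<close>. This summable bound lets Tannery's
  theorem pass to the limit term by term.\<close>

lemma Mertens_Cauchy_product_sums:
  fixes a b :: "nat \<Rightarrow> 'a::{real_normed_algebra,banach}"
  assumes a: "summable a" and b: "summable (\<lambda>k. norm (b k))"
  shows "(\<lambda>k. \<Sum>i\<le>k. a i * b (k - i)) sums ((\<Sum>k. a k) * (\<Sum>k. b k))"
proof -
  have lim: "(\<lambda>n. \<Sum>i<n. a i) \<longlonglongrightarrow> suminf a"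
    using a by (rule summable_LIMSEQ)
  then obtain K where K: "\<And>n. norm (\<Sum>i<n. a i) \<le> K"
    using convergent_imp_Bseq[OF convergentI] by (metis BseqE)
  \<comment> \<open>Column \<open>j\<close> of the triangle \<open>i + j < n\<close>. Truncated
    subtraction makes it empty for \<open>j \<ge> n\<close>, so the infinite sum over
    \<open>j\<close> is a finite one.\<close>
  define f where "f j n = (\<Sum>i<n - j. a i) * b j" for j n
  have "(\<lambda>n. \<Sum>j. f j n) \<longlonglongrightarrow> (\<Sum>j. suminf a * b j)"
  proof (rule tannerys_theorem[THEN conjunct2, THEN conjunct2])
    show "f j \<longlonglongrightarrow> suminf a * b j" for j
    proof -
      have "(\<lambda>n. \<Sum>i<n - j. a i) \<longlonglongrightarrow> suminf a"
        by (rule filterlim_compose[OF lim filterlim_minus_const_nat_at_top])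
      then show ?thesis
        unfolding f_def by (intro tendsto_intros)
    qed
    show "\<forall>\<^sub>F (j, n) in sequentially \<times>\<^sub>F sequentially. norm (f j n) \<le> K * norm (b j)"
      unfolding f_def
      by (intro always_eventually)
        (auto intro: order.trans[OF norm_mult_ineq mult_right_mono[OF K]])
    show "summable (\<lambda>j. K * norm (b j))"
      using b by (rule summable_mult)
  qed simp
  moreover have "(\<Sum>j. f j n) = (\<Sum>k<n. \<Sum>i\<le>k. a i * b (k - i))" for n
  proof -
    have "(\<Sum>j. f j n) = (\<Sum>j<n. f j n)"
      by (rule suminf_finite) (auto simp: f_def)
    also have "\<dots> = (\<Sum>(j, i)\<in>(SIGMA j:{..<n}. {..<n - j}). a i * b j)"
      by (simp add: f_def sum_distrib_right sum.Sigma)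
    also have "\<dots> = (\<Sum>(i, j)\<in>{(i, j). i + j < n}. a i * b j)"
      by (rule sum.reindex_bij_witness[where i = prod.swap and j = prod.swap]) auto
    finally show ?thesis
      by (simp add: sum.triangle_reindex)
  qed
  moreover have "(\<Sum>j. suminf a * b j) = suminf a * suminf b"
    using suminf_mult[OF summable_norm_cancel[OF b]] .
  ultimately show ?thesis
    by (simp add: sums_def)
qed

text \<open>Source of the upper limit \<open>n div p\<close> in \<open>Phi\<close>: for
  \<open>p \<ge> 1\<close>, \<open>p * k \<le> n\<close> is equivalent to
  \<open>k \<le> n div p\<close>.\<close>

lemma sum_multiples:
  fixes f :: "nat \<Rightarrow> 'a::comm_monoid_add"
  assumes "p \<ge> 1"
  shows "(\<Sum>i\<le>n. if p dvd i then f i else 0) = (\<Sum>k=0..n div p. f (p * k))"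
proof -
  have "(\<Sum>i\<le>n. if p dvd i then f i else 0) = (\<Sum>i\<in>{i. i \<le> n \<and> p dvd i}. f i)"
    by (rule sum.mono_neutral_cong_right) auto
  also have "\<dots> = (\<Sum>k=0..n div p. f (p * k))"
    using assms
    by (intro sum.reindex_bij_witness[where i = "\<lambda>k. p * k" and j = "\<lambda>i. i div p"])
      (auto simp: div_le_mono less_eq_div_iff_mult_less_eq mult.commute)
  finally show ?thesis .
qed

text \<open>Convergence at a real offset \<open>s\<close> strictly between \<open>norm t\<close> and
  \<open>\<delta>\<close> forces absolute convergence at the smaller offset
  \<open>t\<close>.\<close>

lemma summable_norm_taylor:
  assumes "f holomorphic_on ball x \<delta>" and "norm t < \<delta>"
  shows "summable (\<lambda>n. norm ((deriv ^^ n) f x / fact n * t ^ n))"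
proof -
  obtain s where s: "norm t < s" "s < \<delta>"
    using assms(2) dense by blast
  then have "0 < s" using norm_ge_zero[of t] by linarith
  have "(\<lambda>n. (deriv ^^ n) f x / fact n * (x + of_real s - x) ^ n) sums f (x + of_real s)"
    using assms(1) by (rule holomorphic_power_series) (use s \<open>0 < s\<close> in \<open>simp add: dist_norm\<close>)
  then show ?thesis
    using powser_insidea[of "\<lambda>n. (deriv ^^ n) f x / fact n" "of_real s" t] s \<open>0 < s\<close>
    by (simp add: sums_iff)
qed

theorem corollary3:
  fixes D :: "complex set" and \<phi>1 \<phi>2 \<psi> :: "complex \<Rightarrow> complex" and \<alpha> \<beta> :: real
    and r p :: nat and lam \<mu> \<nu> :: complex and a :: "nat \<Rightarrow> complex"
  assumes "open D"
    and "\<phi>1 analytic_on D" and "\<phi>2 analytic_on D" and "\<psi> analytic_on D"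
    and "\<alpha> > 0" and "\<alpha> \<noteq> 1" and "\<beta> > 0" and "\<beta> \<noteq> 1"
    and "p \<ge> 1"
    and "\<And>k. a k \<noteq> 0"
    and "\<And>k. \<mu> + \<nu> * of_nat k \<in> \<nat>"
  shows "\<forall>x\<in>D. \<exists>\<delta>>0. ball x \<delta> \<subseteq> D \<and>
    (\<forall>t y \<eta>. t \<noteq> 0 \<longrightarrow> norm t < \<delta> \<longrightarrow>
       summable (\<lambda>n. Phi (Theta \<alpha> \<beta> \<phi>1 \<phi>2 \<psi>) a r lam n p \<mu> \<nu> x y (\<eta> / t ^ p) * t ^ n) \<longrightarrow>
       summable (Lambda_term a r lam \<mu> \<nu> y \<eta>) \<longrightarrow>
       (\<Sum>n. Phi (Theta \<alpha> \<beta> \<phi>1 \<phi>2 \<psi>) a r lam n p \<mu> \<nu> x y (\<eta> / t ^ p) * t ^ n)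
         = of_real \<alpha> powr \<phi>1 x * \<psi> (x + t) * of_real \<beta> powr (- \<phi>2 (x + t))
             * Lambda a r lam \<mu> \<nu> y \<eta>)"
proof
  fix x assume "x \<in> D"
  define f where "f = (\<lambda>x. \<psi> x * of_real \<beta> powr (- \<phi>2 x))"
  \<comment> \<open>Since \<open>\<beta> > 0\<close>, the base stays off the branch cut of
    \<open>powr\<close>.\<close>
  have "f analytic_on D"
    unfolding f_def using assms by (intro analytic_intros) auto
  then have hol: "f holomorphic_on D"
    by (rule analytic_imp_holomorphic)
  \<comment> \<open>Any disc around \<open>x\<close> inside \<open>D\<close> will do, because the
    Taylor series of \<open>f\<close> at \<open>x\<close> represents \<open>f\<close> on all of it.
    Hence \<open>\<delta>\<close> is independent of \<open>y\<close> and
    \<open>\<eta>\<close>.\<close>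
  obtain \<delta> where \<delta>: "\<delta> > 0" "ball x \<delta> \<subseteq> D"
    using \<open>open D\<close> \<open>x \<in> D\<close> open_contains_ball by blast
  then have holb: "f holomorphic_on ball x \<delta>"
    using hol holomorphic_on_subset by blast
  have "(\<Sum>n. Phi (Theta \<alpha> \<beta> \<phi>1 \<phi>2 \<psi>) a r lam n p \<mu> \<nu> x y (\<eta> / t ^ p) * t ^ n)
      = of_real \<alpha> powr \<phi>1 x * \<psi> (x + t) * of_real \<beta> powr (- \<phi>2 (x + t)) * Lambda a r lam \<mu> \<nu> y \<eta>"
    if t: "t \<noteq> 0" "norm t < \<delta>" and summ: "summable (Lambda_term a r lam \<mu> \<nu> y \<eta>)" for t y \<eta>
  proof -
    \<comment> \<open>\<open>A\<close> involves \<open>\<eta>\<close> rather than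
      \<open>\<eta> / t ^ p\<close>: the missing \<open>t ^ (p * k)\<close> in the denominator is
      absorbed by \<open>t ^ n\<close> below.\<close>
    define A where "A i = (if p dvd i then Lambda_term a r lam \<mu> \<nu> y \<eta> (i div p) else 0)" for i
    define B where "B n = (deriv ^^ n) f x / fact n * t ^ n" for n
    \<comment> \<open>Inserting zeros between the terms of a series changes neither its convergence
      nor its sum.\<close>
    have "strict_mono (\<lambda>k. p * k)"
      using \<open>p \<ge> 1\<close> by (auto intro: strict_monoI)
    moreover have "A i = 0" if "i \<notin> range (\<lambda>k. p * k)" for i
      using that by (auto simp: A_def dvd_def)
    moreover have "(\<lambda>k. A (p * k)) sums Lambda a r lam \<mu> \<nu> y \<eta>"
      using summ \<open>p \<ge> 1\<close> by (simp add: A_def Lambda_def summable_sums)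
    ultimately have sumA: "A sums Lambda a r lam \<mu> \<nu> y \<eta>"
      using sums_mono_reindex by blast
    have "(\<lambda>n. (deriv ^^ n) f x / fact n * (x + t - x) ^ n) sums f (x + t)"
      using holb by (rule holomorphic_power_series) (use t in \<open>simp add: dist_norm\<close>)
    then have sumB: "B sums f (x + t)"
      by (simp add: B_def [abs_def])
    have "summable (\<lambda>n. norm (B n))"
      unfolding B_def by (rule summable_norm_taylor[OF holb t(2)])
    \<comment> \<open>The factor \<open>B\<close> is the absolutely convergent one; \<open>A\<close>
      need only converge.\<close>
    then have "(\<lambda>n. \<Sum>i\<le>n. A i * B (n - i)) sums (Lambda a r lam \<mu> \<nu> y \<eta> * f (x + t))"
      using Mertens_Cauchy_product_sums[of A B] sumA sumB by (simp add: sums_iff)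
    then have "(\<lambda>n. of_real \<alpha> powr \<phi>1 x * (\<Sum>i\<le>n. A i * B (n - i))) sums
        (of_real \<alpha> powr \<phi>1 x * (Lambda a r lam \<mu> \<nu> y \<eta> * f (x + t)))"
      by (rule sums_mult)
    moreover have "of_real \<alpha> powr \<phi>1 x * (\<Sum>i\<le>n. A i * B (n - i))
        = Phi (Theta \<alpha> \<beta> \<phi>1 \<phi>2 \<psi>) a r lam n p \<mu> \<nu> x y (\<eta> / t ^ p) * t ^ n" for n
    proof -
      have "(\<Sum>i\<le>n. A i * B (n - i))
          = (\<Sum>i\<le>n. if p dvd i then Lambda_term a r lam \<mu> \<nu> y \<eta> (i div p) * B (n - i) else 0)"
        by (rule sum.cong) (auto simp: A_def)
      also have "\<dots> = (\<Sum>k=0..n div p. Lambda_term a r lam \<mu> \<nu> y \<eta> k * B (n - p * k))"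
        using \<open>p \<ge> 1\<close> by (subst sum_multiples) auto
      finally have "of_real \<alpha> powr \<phi>1 x * (\<Sum>i\<le>n. A i * B (n - i))
          = (\<Sum>k=0..n div p. of_real \<alpha> powr \<phi>1 x
              * (Lambda_term a r lam \<mu> \<nu> y \<eta> k * B (n - p * k)))"
        by (simp add: sum_distrib_left)
      also have "\<dots> = Phi (Theta \<alpha> \<beta> \<phi>1 \<phi>2 \<psi>) a r lam n p \<mu> \<nu> x y (\<eta> / t ^ p) * t ^ n"
        unfolding Phi_def sum_distrib_right
      proof (rule sum.cong)
        fix k assume "k \<in> {0..n div p}"
        then have "p * k \<le> n"
          using \<open>p \<ge> 1\<close> by (simp add: less_eq_div_iff_mult_less_eq mult.commute)
        \<comment> \<open>The first factor goes to \<open>B\<close>, the second cancels the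
          denominator of \<open>(\<eta> / t ^ p) ^ k\<close>. The bound \<open>p * k \<le> n\<close>
          makes \<open>n - p * k\<close> a true difference.\<close>
        then have "t ^ n = t ^ (n - p * k) * (t ^ p) ^ k"
          by (simp flip: power_mult power_add)
        then show "of_real \<alpha> powr \<phi>1 x * (Lambda_term a r lam \<mu> \<nu> y \<eta> k * B (n - p * k))
          = a k / fact (n - p * k) * Theta \<alpha> \<beta> \<phi>1 \<phi>2 \<psi> (n - p * k) x
            * apostol_bernoulli r (nat_of (\<mu> + \<nu> * of_nat k)) y lam * (\<eta> / t ^ p) ^ k * t ^ n"
          using t(1) by (simp add: Lambda_term_def B_def Theta_def f_def power_divide)
      qed simp
      finally show ?thesis .
    qed
    ultimately show ?thesis
      by (simp add: sums_iff f_def mult_ac)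
  qed
  with \<delta> show "\<exists>\<delta>>0. ball x \<delta> \<subseteq> D \<and>
    (\<forall>t y \<eta>. t \<noteq> 0 \<longrightarrow> norm t < \<delta> \<longrightarrow>
       summable (\<lambda>n. Phi (Theta \<alpha> \<beta> \<phi>1 \<phi>2 \<psi>) a r lam n p \<mu> \<nu> x y (\<eta> / t ^ p) * t ^ n) \<longrightarrow>
       summable (Lambda_term a r lam \<mu> \<nu> y \<eta>) \<longrightarrow>
       (\<Sum>n. Phi (Theta \<alpha> \<beta> \<phi>1 \<phi>2 \<psi>) a r lam n p \<mu> \<nu> x y (\<eta> / t ^ p) * t ^ n)
         = of_real \<alpha> powr \<phi>1 x * \<psi> (x + t) * of_real \<beta> powr (- \<phi>2 (x + t))
             * Lambda a r lam \<mu> \<nu> y \<eta>)"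
    by blast
qed

end
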